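(* Let $A$ and $B$ be semiprime $f$-algebras with point separating order duals such that their second order duals $A^{\sim\sim}$ and $B^{\sim\sim}$ (with the Arens multiplication) have unit elements $E_1$ and $E_2$ respectively. Let $T:A\to B$ be a pre-Markov operator. Then $T$ is an algebra homomorphism if and only if its second adjoint operator $T^{\ast\ast}:A^{\sim\sim}\to B^{\sim\sim}$ is an algebra homomorphism.
   Context: All spaces are real. A Riesz algebra is a Riesz space (vector lattice) $A$ with an associative algebra multiplication such that products of positive elements are positive. It is an $f$-algebra if $a\wedge b=0$ implies $ac\wedge b=ca\wedge b=0$ for all $0\le c\in A$. An $f$-algebra is semiprime if $0$ is its only nilpotent element. The order dual $A^{\sim}$ is the Riesz space of all order bounded linear functionals on $A$; it is point separating if for every $a\neq 0$ in $A$ there is $f\in A^{\sim}$ with $f(a)\ne 0$. The second order dual is $A^{\sim\sim}=(A^{\sim})^{\sim}$. The Arens multiplication on $A^{\sim\sim}$ is defined, for $a,b\in A$, $f\in A^{\sim}$, $F,G\in A^{\sim\sim}$, by $(f\cdot a)(b)=f(ab)$, $(F\cdot f)(a)=F(f\cdot a)$, $(F\cdot G)(f)=F(G\cdot f)$. With it, the second order dual of a semiprime $f$-algebra is an $f$-algebra. For an order bounded linear operator $T:A\to B$, the adjoint is $T^{\ast}:B^{\sim}\to A^{\sim}$, $T^{\ast}g=g\circ T$, and the second adjoint is $T^{\ast\ast}:A^{\sim\sim}\to B^{\sim\sim}$, $T^{\ast\ast}F=F\circ T^{\ast}$. A positive linear operator $T:A\to B$ is a pre-Markov operator if $T^{\ast\ast}$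 is a Markov operator, i.e. $T^{\ast\ast}$ is a positive linear operator with $T^{\ast\ast}(E_1)=E_2$. *)

theory Defs
  imports Complex_Main "HOL-Library.Lattice_Algebras"
begin

class riesz_space = ordered_real_vector + lattice
begin

subclass lattice_ab_group_add ..

end

class riesz_algebra = riesz_space + real_algebra +
  assumes riesz_mult_nonneg: "0 \<le> a \<Longrightarrow> 0 \<le> b \<Longrightarrow> 0 \<le> a * b"

class f_algebra = riesz_algebra +
  assumes f_mult_right: "inf a b = 0 \<Longrightarrow> 0 \<le> c \<Longrightarrow> inf (a * c) b = 0"
    and f_mult_left: "inf a b = 0 \<Longrightarrow> 0 \<le> c \<Longrightarrow> inf (c * a) b = 0"

text \<open>The algebras need not have a unit, so the power operator of class \<open>monoid_mult\<close> is not
  available; \<open>((*) a ^^ n) a\<close> is the \<open>(n + 1)\<close>-st power of \<open>a\<close>.\<close>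

definition nilpotent :: "'a::f_algebra \<Rightarrow> bool"
  where "nilpotent a \<longleftrightarrow> (\<exists>n. ((*) a ^^ n) a = 0)"

definition semiprime :: "'a::f_algebra itself \<Rightarrow> bool"
  where "semiprime _ \<longleftrightarrow> (\<forall>a::'a. nilpotent a \<longrightarrow> a = 0)"


section \<open>The order dual\<close>

definition order_bounded :: "('a::order \<Rightarrow> 'b::order) \<Rightarrow> bool"
  where "order_bounded T \<longleftrightarrow> (\<forall>x y. \<exists>u v. T ` {x..y} \<subseteq> {u..v})"

definition positive_operator :: "('a::ordered_real_vector \<Rightarrow> 'b::ordered_real_vector) \<Rightarrow> bool"
  where "positive_operator T \<longleftrightarrow> linear T \<and> (\<forall>x\<ge>0. 0 \<le> T x)"

lemma order_bounded_realI:
  fixes f :: "'a::order \<Rightarrow> real"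
  assumes "\<And>x y. \<exists>M. \<forall>z\<in>{x..y}. \<bar>f z\<bar> \<le> M"
  shows "order_bounded f"
  unfolding order_bounded_def
proof (intro allI)
  fix x y
  obtain M where "\<forall>z\<in>{x..y}. \<bar>f z\<bar> \<le> M" using assms by blast
  then have "f ` {x..y} \<subseteq> {-M..M}" by (auto simp: abs_le_iff minus_le_iff)
  then show "\<exists>u v. f ` {x..y} \<subseteq> {u..v}" by blast
qed

lemma order_bounded_realD:
  fixes f :: "'a::order \<Rightarrow> real"
  assumes "order_bounded f"
  shows "\<exists>M. \<forall>z\<in>{x..y}. \<bar>f z\<bar> \<le> M"
proof -
  obtain u v where uv: "f ` {x..y} \<subseteq> {u..v}" using assms unfolding order_bounded_def by blast
  have "\<bar>f z\<bar> \<le> max \<bar>u\<bar> \<bar>v\<bar>" if "z \<in> {x..y}" for z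
  proof -
    have "f z \<in> {u..v}" using uv that by blast
    then show ?thesis by auto
  qed
  then show ?thesis by blast
qed

lemma positive_operator_mono:
  assumes "positive_operator T" "x \<le> y"
  shows "T x \<le> T y"
proof -
  have "0 \<le> T (y - x)" using assms unfolding positive_operator_def by simp
  then show ?thesis using assms by (simp add: positive_operator_def linear_diff)
qed

lemma positive_operator_order_bounded:
  assumes "positive_operator T"
  shows "order_bounded T"
  unfolding order_bounded_def
proof (intro allI)
  fix x y
  have "T ` {x..y} \<subseteq> {T x..T y}" using positive_operator_mono[OF assms] by auto
  then show "\<exists>u v. T ` {x..y} \<subseteq> {u..v}" by blast
qed

lemma order_bounded_const: "order_bounded (\<lambda>_. c)"
proof -
  have "(\<lambda>_. c) ` {x..y} \<subseteq> {c..c}" for x y by auto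
  then show ?thesis unfolding order_bounded_def by blast
qed

lemma order_bounded_compose:
  assumes "order_bounded f" "order_bounded g"
  shows "order_bounded (\<lambda>x. f (g x))"
  unfolding order_bounded_def
proof (intro allI)
  fix x y
  obtain u v where "g ` {x..y} \<subseteq> {u..v}" using assms(2) unfolding order_bounded_def by blast
  moreover obtain p q where "f ` {u..v} \<subseteq> {p..q}"
    using assms(1) unfolding order_bounded_def by blast
  ultimately have "(\<lambda>x. f (g x)) ` {x..y} \<subseteq> {p..q}" by blast
  then show "\<exists>u v. (\<lambda>x. f (g x)) ` {x..y} \<subseteq> {u..v}" by blast
qed

lemma order_bounded_add:
  fixes f g :: "'a::order \<Rightarrow> 'b::ordered_ab_group_add"
  assumes "order_bounded f" "order_bounded g"
  shows "order_bounded (\<lambda>x. f x + g x)"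
  unfolding order_bounded_def
proof (intro allI)
  fix x y
  obtain u v where a: "f ` {x..y} \<subseteq> {u..v}" using assms(1) unfolding order_bounded_def by blast
  obtain p q where b: "g ` {x..y} \<subseteq> {p..q}" using assms(2) unfolding order_bounded_def by blast
  have "f z + g z \<in> {u + p..v + q}" if "z \<in> {x..y}" for z
  proof -
    have "f z \<in> {u..v}" "g z \<in> {p..q}" using a b that by blast+
    then show ?thesis by (simp add: add_mono)
  qed
  then have "(\<lambda>x. f x + g x) ` {x..y} \<subseteq> {u + p..v + q}" by blast
  then show "\<exists>u v. (\<lambda>x. f x + g x) ` {x..y} \<subseteq> {u..v}" by blast
qed

lemma order_bounded_uminus:
  fixes f :: "'a::order \<Rightarrow> 'b::ordered_ab_group_add"
  assumes "order_bounded f"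
  shows "order_bounded (\<lambda>x. - f x)"
  unfolding order_bounded_def
proof (intro allI)
  fix x y
  obtain u v where a: "f ` {x..y} \<subseteq> {u..v}" using assms(1) unfolding order_bounded_def by blast
  have "- f z \<in> {- v..- u}" if "z \<in> {x..y}" for z
  proof -
    have "f z \<in> {u..v}" using a that by blast
    then show ?thesis by simp
  qed
  then have "(\<lambda>x. - f x) ` {x..y} \<subseteq> {- v..- u}" by blast
  then show "\<exists>u v. (\<lambda>x. - f x) ` {x..y} \<subseteq> {u..v}" by blast
qed

lemma order_bounded_diff:
  fixes f g :: "'a::order \<Rightarrow> 'b::ordered_ab_group_add"
  assumes "order_bounded f" "order_bounded g"
  shows "order_bounded (\<lambda>x. f x - g x)"
  using order_bounded_add[OF assms(1) order_bounded_uminus[OF assms(2)]] by simp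

lemma order_bounded_scaleR:
  fixes f :: "'a::order \<Rightarrow> real"
  assumes "order_bounded f"
  shows "order_bounded (\<lambda>x. c * f x)"
proof (rule order_bounded_realI)
  fix x y
  obtain M where M: "\<forall>z\<in>{x..y}. \<bar>f z\<bar> \<le> M" using order_bounded_realD[OF assms] by blast
  have "\<forall>z\<in>{x..y}. \<bar>c * f z\<bar> \<le> \<bar>c\<bar> * M" using M by (auto simp: abs_mult intro!: mult_left_mono)
  then show "\<exists>M. \<forall>z\<in>{x..y}. \<bar>c * f z\<bar> \<le> M" by blast
qed

typedef (overloaded) 'a order_dual =
  "{f :: 'a::riesz_space \<Rightarrow> real. linear f \<and> order_bounded f}"
  morphisms dual_apply Abs_order_dual
proof
  show "(\<lambda>_. 0) \<in> {f :: 'a \<Rightarrow> real. linear f \<and> order_bounded f}"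
    by (simp add: order_bounded_const linear_zero)
qed

setup_lifting type_definition_order_dual

lemma linear_dual_apply: "linear (dual_apply f)"
  using dual_apply[of f] by simp

lemma order_bounded_dual_apply: "order_bounded (dual_apply f)"
  using dual_apply[of f] by simp

lemma order_dual_eqI: "(\<And>x. dual_apply f x = dual_apply g x) \<Longrightarrow> f = g"
  using dual_apply_inject by blast

instantiation order_dual :: (riesz_space) real_vector
begin

lift_definition zero_order_dual :: "'a order_dual" is "\<lambda>_. 0"
  by (simp add: order_bounded_const linear_zero)

lift_definition plus_order_dual :: "'a order_dual \<Rightarrow> 'a order_dual \<Rightarrow> 'a order_dual"
  is "\<lambda>f g x. f x + g x"
  by (simp add: linear_compose_add order_bounded_add)

lift_definition minus_order_dual :: "'a order_dual \<Rightarrow> 'a order_dual \<Rightarrow> 'a order_dual"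
  is "\<lambda>f g x. f x - g x"
  by (simp add: linear_compose_sub order_bounded_diff)

lift_definition uminus_order_dual :: "'a order_dual \<Rightarrow> 'a order_dual"
  is "\<lambda>f x. - f x"
  by (simp add: linear_compose_neg order_bounded_uminus)

lift_definition scaleR_order_dual :: "real \<Rightarrow> 'a order_dual \<Rightarrow> 'a order_dual"
  is "\<lambda>c f x. c * f x"
  using linear_compose_scale_right[where 'b = real]
  by (fastforce simp: order_bounded_scaleR)

instance
  by intro_classes (transfer; auto simp: algebra_simps)+

end

lemma riesz_split: "sup x 0 - sup (- x) 0 = (x::'a::riesz_space)"
proof -
  have "sup (- x) 0 = - inf x 0" by (simp add: neg_inf_eq_sup)
  then show ?thesis using prts[of x] by (simp only: pprt_def nprt_def diff_minus_eq_add)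
qed

instantiation order_dual :: (riesz_space) ordered_real_vector
begin

lift_definition less_eq_order_dual :: "'a order_dual \<Rightarrow> 'a order_dual \<Rightarrow> bool"
  is "\<lambda>f g. \<forall>x\<ge>0. f x \<le> g x" .

definition less_order_dual :: "'a order_dual \<Rightarrow> 'a order_dual \<Rightarrow> bool"
  where "less_order_dual f g \<longleftrightarrow> f \<le> g \<and> \<not> g \<le> f"

instance
proof
  fix f g h :: "'a order_dual" and c d :: real
  show "(f < g) = (f \<le> g \<and> \<not> g \<le> f)" by (rule less_order_dual_def)
  show "f \<le> f" by transfer simp
  show "f \<le> g \<Longrightarrow> g \<le> h \<Longrightarrow> f \<le> h" by transfer (meson order_trans)
  show "f \<le> g \<Longrightarrow> h + f \<le> h + g" by transfer simp
  show "f \<le> g \<Longrightarrow> 0 \<le> c \<Longrightarrow> c *\<^sub>R f \<le> c *\<^sub>R g" by transfer (simp add: mult_left_mono)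
  show "c \<le> d \<Longrightarrow> 0 \<le> f \<Longrightarrow> c *\<^sub>R f \<le> d *\<^sub>R f" by transfer (simp add: mult_right_mono)
  show "f = g" if "f \<le> g" "g \<le> f"
  proof (rule order_dual_eqI)
    fix x
    have pos: "dual_apply f y = dual_apply g y" if "0 \<le> y" for y
      using \<open>f \<le> g\<close> \<open>g \<le> f\<close> that by transfer (simp add: order_antisym)
    have "dual_apply f (sup x 0 - sup (- x) 0) = dual_apply g (sup x 0 - sup (- x) 0)"
      by (simp only: linear_diff[OF linear_dual_apply] pos sup_ge2)
    then show "dual_apply f x = dual_apply g x" by (simp only: riesz_split)
  qed
qed

end

lemma dual_le_iff: "f \<le> g \<longleftrightarrow> (\<forall>x\<ge>0. dual_apply f x \<le> dual_apply g x)"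
  by (rule less_eq_order_dual.rep_eq)


section \<open>The Riesz--Kantorovich theorem\<close>

lemma riesz_decomposition:
  fixes x y z :: "'a::riesz_space"
  assumes "0 \<le> x" "0 \<le> y" "0 \<le> z" "z \<le> x + y"
  shows "\<exists>a b. a \<in> {0..x} \<and> b \<in> {0..y} \<and> z = a + b"
proof (intro exI conjI)
  show "inf z x \<in> {0..x}" using assms by simp
  have "z - y \<le> inf z x" using assms by (simp add: diff_le_eq)
  then have "z - inf z x \<le> y" by (simp only: diff_le_eq add.commute)
  moreover have "0 \<le> z - inf z x" by (simp only: le_diff_eq add_0 inf_le1)
  ultimately show "z - inf z x \<in> {0..y}" by simp
  show "z = inf z x + (z - inf z x)" by (rule add_diff_eq[THEN trans, OF add_diff_cancel_left', symmetric])
qed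

lemma linear_extension_of_cone_map:
  fixes p :: "'a::riesz_space \<Rightarrow> real"
  assumes add: "\<And>x y. 0 \<le> x \<Longrightarrow> 0 \<le> y \<Longrightarrow> p (x + y) = p x + p y"
    and scale: "\<And>c x. 0 < c \<Longrightarrow> 0 \<le> x \<Longrightarrow> p (c *\<^sub>R x) = c * p x"
  shows "linear (\<lambda>x. p (sup x 0) - p (sup (- x) 0))"
    and "0 \<le> x \<Longrightarrow> p (sup x 0) - p (sup (- x) 0) = p x"
proof -
  define h where "h = (\<lambda>x. p (sup x 0) - p (sup (- x) 0))"
  have p0: "p 0 = 0" using add[of 0 0] by simp
  have h: "h (u - v) = p u - p v" if "0 \<le> u" "0 \<le> v" for u v
  proof -
    have "sup (u - v) 0 + v = u + sup (- (u - v)) 0"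
    proof -
      have "s + v = u + t" if "s - t = u - v" for s t
        using that by (simp add: algebra_simps)
      then show ?thesis using riesz_split by blast
    qed
    then have "p (sup (u - v) 0) + p v = p u + p (sup (- (u - v)) 0)"
      using add[of "sup (u - v) 0" v] add[of u "sup (- (u - v)) 0"] that by simp
    then show ?thesis unfolding h_def by simp
  qed
  have pos: "h x = p x" if "0 \<le> x" for x using h[of x 0] that p0 by simp
  have neg: "h (- x) = - h x" for x unfolding h_def by simp
  have hadd: "h (x + y) = h x + h y" for x y
  proof -
    have "x + y = (sup x 0 + sup y 0) - (sup (- x) 0 + sup (- y) 0)"
      by (simp only: add_diff_add riesz_split)
    then have "h (x + y) = p (sup x 0 + sup y 0) - p (sup (- x) 0 + sup (- y) 0)"
      using h[of "sup x 0 + sup y 0" "sup (- x) 0 + sup (- y) 0"] by simp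
    also have "\<dots> = h x + h y" unfolding h_def by (simp add: add)
    finally show ?thesis .
  qed
  have hscale_pos: "h (c *\<^sub>R x) = c * h x" if "0 < c" for c x
  proof -
    have "c *\<^sub>R x = c *\<^sub>R sup x 0 - c *\<^sub>R sup (- x) 0"
      by (simp only: riesz_split flip: scaleR_right_diff_distrib)
    then have "h (c *\<^sub>R x) = p (c *\<^sub>R sup x 0) - p (c *\<^sub>R sup (- x) 0)"
      using h[of "c *\<^sub>R sup x 0" "c *\<^sub>R sup (- x) 0"] that by (simp add: scaleR_nonneg_nonneg)
    also have "\<dots> = c * h x"
      unfolding h_def using that by (simp add: scale right_diff_distrib)
    finally show ?thesis .
  qed
  have hscale: "h (c *\<^sub>R x) = c * h x" for c x
  proof (cases c "0::real" rule: linorder_cases)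
    case less
    then have "h (c *\<^sub>R x) = - h ((- c) *\<^sub>R x)" using neg[of "(- c) *\<^sub>R x"] by simp
    then show ?thesis using hscale_pos[of "- c" x] less by simp
  next
    case equal
    then show ?thesis using pos[of 0] p0 by simp
  qed (rule hscale_pos)
  show "linear (\<lambda>x. p (sup x 0) - p (sup (- x) 0))"
    using hadd hscale unfolding h_def by (intro linearI) simp_all
  show "0 \<le> x \<Longrightarrow> p (sup x 0) - p (sup (- x) 0) = p x"
    using pos unfolding h_def by simp
qed

text \<open>On the positive cone, the positive part of \<open>f\<close> is \<open>x \<mapsto> sup {f y | 0 \<le> y \<le> x}\<close>.\<close>

definition cone_sup :: "('a::riesz_space \<Rightarrow> real) \<Rightarrow> 'a \<Rightarrow> real"
  where "cone_sup f x = (SUP y\<in>{0..x}. f y)"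

context
  fixes f :: "'a::riesz_space \<Rightarrow> real"
  assumes lin: "linear f" and bdd: "order_bounded f"
begin

lemma cone_sup_bdd: "bdd_above (f ` {0..x})"
proof -
  obtain u v where "f ` {0..x} \<subseteq> {u..v}" using bdd unfolding order_bounded_def by blast
  then show ?thesis by (meson bdd_above_Icc bdd_above_mono)
qed

lemma cone_sup_upper: "0 \<le> y \<Longrightarrow> y \<le> x \<Longrightarrow> f y \<le> cone_sup f x"
  unfolding cone_sup_def by (intro cSUP_upper cone_sup_bdd) simp

lemma cone_sup_least: "0 \<le> x \<Longrightarrow> (\<And>y. 0 \<le> y \<Longrightarrow> y \<le> x \<Longrightarrow> f y \<le> M) \<Longrightarrow> cone_sup f x \<le> M"
  unfolding cone_sup_def by (intro cSUP_least) auto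

lemma cone_sup_nonneg: "0 \<le> x \<Longrightarrow> 0 \<le> cone_sup f x"
  using cone_sup_upper[of 0 x] linear_0[OF lin] by simp

lemma cone_sup_add:
  assumes "0 \<le> x" "0 \<le> y"
  shows "cone_sup f (x + y) = cone_sup f x + cone_sup f y"
proof (rule antisym)
  show "cone_sup f (x + y) \<le> cone_sup f x + cone_sup f y"
  proof (rule cone_sup_least)
    fix z assume "0 \<le> z" "z \<le> x + y"
    then obtain a b where "a \<in> {0..x}" "b \<in> {0..y}" "z = a + b"
      using riesz_decomposition assms by blast
    then show "f z \<le> cone_sup f x + cone_sup f y"
      using cone_sup_upper[of a x] cone_sup_upper[of b y] by (simp add: linear_add[OF lin])
  qed (use assms in simp)
  have "f a + f b \<le> cone_sup f (x + y)" if "a \<in> {0..x}" "b \<in> {0..y}" for a b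
    using that cone_sup_upper[of "a + b" "x + y"]
    by (simp add: linear_add[OF lin] add_mono)
  then have "cone_sup f y \<le> cone_sup f (x + y) - f a" if "a \<in> {0..x}" for a
    using that assms by (intro cone_sup_least) (simp_all add: le_diff_eq add.commute[of _ "f a"])
  then have "f a \<le> cone_sup f (x + y) - cone_sup f y" if "a \<in> {0..x}" for a
    using that by (simp add: le_diff_eq add.commute)
  then have "cone_sup f x \<le> cone_sup f (x + y) - cone_sup f y"
    using assms by (intro cone_sup_least) auto
  then show "cone_sup f x + cone_sup f y \<le> cone_sup f (x + y)" by simp
qed

lemma cone_sup_scale:
  assumes "0 < c" "0 \<le> x"
  shows "cone_sup f (c *\<^sub>R x) = c * cone_sup f x"
proof -
  have le: "cone_sup f (c *\<^sub>R x) \<le> c * cone_sup f x" if c: "0 < c" and x: "0 \<le> x" for c x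
  proof (rule cone_sup_least)
    fix y assume y: "0 \<le> y" "y \<le> c *\<^sub>R x"
    have "inverse c *\<^sub>R y \<le> inverse c *\<^sub>R (c *\<^sub>R x)"
      using y c by (intro scaleR_left_mono) auto
    then have "f (inverse c *\<^sub>R y) \<le> cone_sup f x"
      using y c by (intro cone_sup_upper) (auto simp: scaleR_nonneg_nonneg)
    then show "f y \<le> c * cone_sup f x"
      using c by (simp add: linear_scale[OF lin] field_simps)
  qed (use that in \<open>simp add: scaleR_nonneg_nonneg\<close>)
  have "cone_sup f x \<le> inverse c * cone_sup f (c *\<^sub>R x)"
    using le[of "inverse c" "c *\<^sub>R x"] assms by (simp add: scaleR_nonneg_nonneg)
  then have "c * cone_sup f x \<le> cone_sup f (c *\<^sub>R x)"
    using assms by (simp add: field_simps)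
  with le[OF assms] show ?thesis by simp
qed

lemmas positive_part_linear = linear_extension_of_cone_map(1)[OF cone_sup_add cone_sup_scale]
lemmas positive_part_cone = linear_extension_of_cone_map(2)[OF cone_sup_add cone_sup_scale]

lemma positive_part_order_bounded:
  "order_bounded (\<lambda>x. cone_sup f (sup x 0) - cone_sup f (sup (- x) 0))"
proof (rule positive_operator_order_bounded)
  show "positive_operator (\<lambda>x. cone_sup f (sup x 0) - cone_sup f (sup (- x) 0))"
    using positive_part_linear positive_part_cone cone_sup_nonneg
    unfolding positive_operator_def by simp
qed

end

lift_definition positive_part :: "'a::riesz_space order_dual \<Rightarrow> 'a order_dual"
  is "\<lambda>f x. cone_sup f (sup x 0) - cone_sup f (sup (- x) 0)"
  using positive_part_linear positive_part_order_bounded by blast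

lemma positive_part_apply: "0 \<le> x \<Longrightarrow> dual_apply (positive_part f) x = cone_sup (dual_apply f) x"
  by (simp add: positive_part.rep_eq positive_part_cone linear_dual_apply order_bounded_dual_apply)

lemma positive_part_nonneg: "0 \<le> positive_part f"
  by (simp add: dual_le_iff positive_part_apply cone_sup_nonneg linear_dual_apply
      order_bounded_dual_apply zero_order_dual.rep_eq)

lemma positive_part_ge: "f \<le> positive_part f"
  by (simp add: dual_le_iff positive_part_apply cone_sup_upper linear_dual_apply
      order_bounded_dual_apply)

lemma positive_part_least:
  assumes "0 \<le> h" "f \<le> h"
  shows "positive_part f \<le> h"
  unfolding dual_le_iff
proof (intro allI impI)
  fix x :: 'a assume x: "0 \<le> x"
  have "dual_apply f y \<le> dual_apply h x" if y: "0 \<le> y" "y \<le> x" for y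
  proof -
    have "dual_apply f y \<le> dual_apply h y" using assms(2) y by (simp add: dual_le_iff)
    also have "0 \<le> dual_apply h (x - y)"
      using assms(1) y by (simp add: dual_le_iff zero_order_dual.rep_eq)
    then have "dual_apply h y \<le> dual_apply h x" by (simp add: linear_diff[OF linear_dual_apply])
    finally show ?thesis .
  qed
  then show "dual_apply (positive_part f) x \<le> dual_apply h x"
    using x by (simp add: positive_part_apply cone_sup_least linear_dual_apply
        order_bounded_dual_apply)
qed

instantiation order_dual :: (riesz_space) riesz_space
begin

definition sup_order_dual :: "'a order_dual \<Rightarrow> 'a order_dual \<Rightarrow> 'a order_dual"
  where "sup f g = g + positive_part (f - g)"

definition inf_order_dual :: "'a order_dual \<Rightarrow> 'a order_dual \<Rightarrow> 'a order_dual"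
  where "inf f g = f - positive_part (f - g)"

instance
proof
  fix f g h :: "'a order_dual"
  show "f \<le> sup f g" "g \<le> sup f g"
    using positive_part_ge[of "f - g"] positive_part_nonneg[of "f - g"]
    unfolding sup_order_dual_def by (simp_all add: diff_le_eq add.commute)
  show "inf f g \<le> f" "inf f g \<le> g"
    using positive_part_ge[of "f - g"] positive_part_nonneg[of "f - g"]
    unfolding inf_order_dual_def by (simp_all add: algebra_simps)
  show "sup g h \<le> f" if "g \<le> f" "h \<le> f"
    using positive_part_least[of "f - h" "g - h"] that
    unfolding sup_order_dual_def by (simp add: le_diff_eq add.commute)
  show "f \<le> inf g h" if "f \<le> g" "f \<le> h"
    using positive_part_least[of "g - f" "g - h"] that
    unfolding inf_order_dual_def by (simp add: algebra_simps)
qed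

end

type_synonym 'a second_dual = "'a order_dual order_dual"

definition point_separating_dual :: "'a::riesz_space itself \<Rightarrow> bool"
  where "point_separating_dual _ \<longleftrightarrow> (\<forall>a::'a. a \<noteq> 0 \<longrightarrow> (\<exists>f. dual_apply f a \<noteq> 0))"


section \<open>The Arens multiplication\<close>

lemma order_bounded_diff_of_positive:
  assumes "\<And>x. T x = P x - N x" "positive_operator P" "positive_operator N"
  shows "order_bounded T"
proof -
  have "T = (\<lambda>x. P x - N x)" using assms(1) by blast
  then show ?thesis
    using assms by (simp add: order_bounded_diff positive_operator_order_bounded)
qed

lemma linear_Abs_order_dual_apply:
  assumes "linear f" "order_bounded f"
  shows "dual_apply (Abs_order_dual f) = f"
  using assms by (simp add: Abs_order_dual_inverse)

lemma positive_operator_dual_apply: "0 \<le> f \<Longrightarrow> positive_operator (dual_apply f)"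
  by (simp add: positive_operator_def linear_dual_apply dual_le_iff zero_order_dual.rep_eq)

lemma dual_apply_order_bounded_compose:
  assumes "linear S" "order_bounded S"
  shows "linear (\<lambda>x. dual_apply f (S x)) \<and> order_bounded (\<lambda>x. dual_apply f (S x))"
  using linear_compose[OF assms(1) linear_dual_apply[of f]]
    order_bounded_compose[OF order_bounded_dual_apply[of f] assms(2)]
  by (simp add: o_def)

lemma mult_left_linear: "linear ((*) (a::'a::riesz_algebra))"
  by (rule linearI) (simp_all add: distrib_left)

lemma mult_left_order_bounded: "order_bounded ((*) (a::'a::riesz_algebra))"
proof (rule order_bounded_diff_of_positive)
  show "a * x = sup a 0 * x - sup (- a) 0 * x" for x
    by (simp only: riesz_split flip: left_diff_distrib)
  show "positive_operator ((*) (sup a 0))" "positive_operator ((*) (sup (- a) 0))"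
    by (simp_all add: positive_operator_def mult_left_linear riesz_mult_nonneg)
qed

text \<open>The three stages of the Arens construction:
  \<open>(f \<cdot> a)(b) = f (a b)\<close>, \<open>(F \<cdot> f)(a) = F (f \<cdot> a)\<close>, \<open>(F \<cdot> G)(f) = F (G \<cdot> f)\<close>.\<close>

lift_definition arens_dual_elem :: "'a::riesz_algebra order_dual \<Rightarrow> 'a \<Rightarrow> 'a order_dual"
  is "\<lambda>f a b. f (a * b)"
  using linear_compose[OF mult_left_linear] order_bounded_compose[OF _ mult_left_order_bounded]
  by (fastforce simp: o_def)

lemma arens_dual_elem_linear_left: "linear (\<lambda>f. arens_dual_elem f a)"
  by (rule linearI; rule order_dual_eqI)
    (simp_all add: arens_dual_elem.rep_eq plus_order_dual.rep_eq scaleR_order_dual.rep_eq)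

lemma arens_dual_elem_linear_right: "linear (arens_dual_elem f)"
  by (rule linearI; rule order_dual_eqI)
    (simp_all add: arens_dual_elem.rep_eq plus_order_dual.rep_eq scaleR_order_dual.rep_eq
      distrib_right linear_add[OF linear_dual_apply] linear_scale[OF linear_dual_apply])

lemma arens_dual_elem_nonneg: "0 \<le> f \<Longrightarrow> 0 \<le> a \<Longrightarrow> 0 \<le> arens_dual_elem f a"
  by (simp add: dual_le_iff arens_dual_elem.rep_eq zero_order_dual.rep_eq riesz_mult_nonneg)

lemma arens_dual_elem_order_bounded: "order_bounded (arens_dual_elem f)"
proof (rule order_bounded_diff_of_positive)
  show "arens_dual_elem f a = arens_dual_elem (sup f 0) a - arens_dual_elem (sup (- f) 0) a" for a
    using linear_diff[OF arens_dual_elem_linear_left[of a], of "sup f 0" "sup (- f) 0"]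
    by (simp only: riesz_split)
  show "positive_operator (arens_dual_elem (sup f 0))"
    "positive_operator (arens_dual_elem (sup (- f) 0))"
    by (simp_all add: positive_operator_def arens_dual_elem_linear_right arens_dual_elem_nonneg)
qed

lift_definition arens_second_dual ::
  "'a::riesz_algebra second_dual \<Rightarrow> 'a order_dual \<Rightarrow> 'a order_dual"
  is "\<lambda>F f a. dual_apply F (arens_dual_elem f a)"
  using dual_apply_order_bounded_compose[OF arens_dual_elem_linear_right
      arens_dual_elem_order_bounded] by blast

lemma arens_second_dual_linear_left: "linear (\<lambda>F. arens_second_dual F f)"
  by (rule linearI; rule order_dual_eqI)
    (simp_all add: arens_second_dual.rep_eq plus_order_dual.rep_eq scaleR_order_dual.rep_eq)

lemma arens_second_dual_linear_right: "linear (arens_second_dual F)"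
  by (rule linearI; rule order_dual_eqI)
    (simp_all add: arens_second_dual.rep_eq plus_order_dual.rep_eq scaleR_order_dual.rep_eq
      linear_add[OF arens_dual_elem_linear_left] linear_scale[OF arens_dual_elem_linear_left]
      linear_add[OF linear_dual_apply] linear_scale[OF linear_dual_apply])

lemma arens_second_dual_nonneg: "0 \<le> F \<Longrightarrow> 0 \<le> f \<Longrightarrow> 0 \<le> arens_second_dual F f"
  by (simp add: dual_le_iff[of 0 "arens_second_dual F f"] arens_second_dual.rep_eq
      zero_order_dual.rep_eq arens_dual_elem_nonneg
      positive_operator_dual_apply[unfolded positive_operator_def])

lemma arens_second_dual_order_bounded: "order_bounded (arens_second_dual F)"
proof (rule order_bounded_diff_of_positive)
  show "arens_second_dual F f = arens_second_dual (sup F 0) f - arens_second_dual (sup (- F) 0) f"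
    for f
    using linear_diff[OF arens_second_dual_linear_left[of f], of "sup F 0" "sup (- F) 0"]
    by (simp only: riesz_split)
  show "positive_operator (arens_second_dual (sup F 0))"
    "positive_operator (arens_second_dual (sup (- F) 0))"
    by (simp_all add: positive_operator_def arens_second_dual_linear_right
        arens_second_dual_nonneg)
qed

lift_definition arens_mult ::
  "'a::riesz_algebra second_dual \<Rightarrow> 'a second_dual \<Rightarrow> 'a second_dual"
  is "\<lambda>F G f. dual_apply F (arens_second_dual G f)"
  using dual_apply_order_bounded_compose[OF arens_second_dual_linear_right
      arens_second_dual_order_bounded] by blast

definition arens_unit :: "'a::riesz_algebra second_dual \<Rightarrow> bool"
  where "arens_unit E \<longleftrightarrow> (\<forall>F. arens_mult E F = F \<and> arens_mult F E = F)"


section \<open>Adjoints and pre-Markov operators\<close>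

text \<open>\<open>Abs_order_dual\<close> is unspecified off the order bounded linear functionals, so \<open>adjoint T\<close>
  is the adjoint of \<open>T\<close> only for order bounded linear \<open>T\<close>.\<close>

definition adjoint :: "('a::riesz_space \<Rightarrow> 'b::riesz_space) \<Rightarrow> 'b order_dual \<Rightarrow> 'a order_dual"
  where "adjoint T g = Abs_order_dual (\<lambda>x. dual_apply g (T x))"

definition second_adjoint ::
    "('a::riesz_space \<Rightarrow> 'b::riesz_space) \<Rightarrow> 'a second_dual \<Rightarrow> 'b second_dual"
  where "second_adjoint T = adjoint (adjoint T)"

lemma adjoint_apply:
  assumes "linear T" "order_bounded T"
  shows "dual_apply (adjoint T g) x = dual_apply g (T x)"
  using dual_apply_order_bounded_compose[OF assms, of g]
  by (simp add: adjoint_def linear_Abs_order_dual_apply)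

lemma positive_operator_adjoint:
  assumes "positive_operator T"
  shows "positive_operator (adjoint T)"
proof -
  have T: "linear T" "order_bounded T" "\<And>x. 0 \<le> x \<Longrightarrow> 0 \<le> T x"
    using assms positive_operator_order_bounded unfolding positive_operator_def by auto
  have "linear (adjoint T)"
    by (rule linearI; rule order_dual_eqI)
      (simp_all add: adjoint_apply[OF T(1,2)] plus_order_dual.rep_eq scaleR_order_dual.rep_eq)
  then show ?thesis
    by (auto simp: positive_operator_def dual_le_iff adjoint_apply[OF T(1,2)] T(3)
        zero_order_dual.rep_eq)
qed

lemma second_adjoint_apply:
  assumes "positive_operator T"
  shows "dual_apply (second_adjoint T F) g = dual_apply F (adjoint T g)"
  using positive_operator_adjoint[OF assms]
  by (simp add: second_adjoint_def adjoint_apply positive_operator_order_bounded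
      positive_operator_def)

definition markov_operator ::
    "'a::ordered_real_vector \<Rightarrow> 'b::ordered_real_vector \<Rightarrow> ('a \<Rightarrow> 'b) \<Rightarrow> bool"
  where "markov_operator e1 e2 S \<longleftrightarrow> positive_operator S \<and> S e1 = e2"

definition pre_markov_operator ::
    "'a::f_algebra second_dual \<Rightarrow> 'b::f_algebra second_dual \<Rightarrow> ('a \<Rightarrow> 'b) \<Rightarrow> bool"
  where "pre_markov_operator E1 E2 T \<longleftrightarrow>
    positive_operator T \<and> markov_operator E1 E2 (second_adjoint T)"

text \<open>The multiplications are passed explicitly, because the Arens multiplication is not an
  instance of \<open>times\<close>.\<close>

definition algebra_homomorphism ::
    "('a::real_vector \<Rightarrow> 'a \<Rightarrow> 'a) \<Rightarrow> ('b::real_vector \<Rightarrow> 'b \<Rightarrow> 'b) \<Rightarrow> ('a \<Rightarrow> 'b) \<Rightarrow> bool"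
  where "algebra_homomorphism m1 m2 S \<longleftrightarrow> linear S \<and> (\<forall>x y. S (m1 x y) = m2 (S x) (S y))"

end

theory Submission
  imports Defs
begin

text \<open>
  Both directions come from the Arens multiplication being built functorially out of the
  multiplication of the algebra.

  If a positive operator \<open>T\<close> is multiplicative, its adjoints commute with each of the three stages
  of the Arens construction: \<open>T\<^sup>*(g \<cdot> Ta) = T\<^sup>*g \<cdot> a\<close> (lemma \<open>adjoint_arens_dual_elem\<close>), hence
  \<open>T\<^sup>*(T\<^sup>*\<^sup>*G \<cdot> g) = G \<cdot> T\<^sup>*g\<close> (lemma \<open>adjoint_arens_second_dual\<close>), and applying \<open>F\<close> to the latter
  gives \<open>T\<^sup>*\<^sup>*F \<cdot> T\<^sup>*\<^sup>*G = T\<^sup>*\<^sup>*(F \<cdot> G)\<close> (lemma \<open>second_adjoint_arens_mult\<close>).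

  Conversely, evaluation at a point embeds an algebra into its second order dual. The embedding
  carries the given multiplication to the Arens multiplication and intertwines \<open>T\<close> with
  \<open>T\<^sup>*\<^sup>*\<close>. So if \<open>T\<^sup>*\<^sup>*\<close> is multiplicative, then \<open>T (x y)\<close> and \<open>T x T y\<close> have the same image in the
  second dual of the codomain; they are equal because the order dual of the codomain separates
  points.
\<close>
lemma positive_operatorD:
  assumes "positive_operator T"
  shows "linear T" "order_bounded T"
  using assms positive_operator_order_bounded by (auto simp: positive_operator_def)

lemma positive_operator_second_adjoint:
  "positive_operator T \<Longrightarrow> positive_operator (second_adjoint T)"
  by (simp add: second_adjoint_def positive_operator_adjoint)

text \<open>At \<open>b\<close> the two sides are \<open>g (T a T b)\<close> and \<open>g (T (a b))\<close>: this is the one stage at which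
  multiplicativity itself enters; the later stages inherit it by duality.\<close>

lemma adjoint_arens_dual_elem:
  fixes T :: "'a::riesz_algebra \<Rightarrow> 'b::riesz_algebra"
  assumes T: "positive_operator T" and mult: "\<And>x y. T (x * y) = T x * T y"
  shows "adjoint T (arens_dual_elem g (T a)) = arens_dual_elem (adjoint T g) a"
  by (rule order_dual_eqI)
    (simp add: adjoint_apply[OF positive_operatorD[OF T]] arens_dual_elem.rep_eq mult)

text \<open>At \<open>a\<close> the left side is \<open>G (T\<^sup>*(g \<cdot> Ta))\<close> and the right side \<open>G (T\<^sup>*g \<cdot> a)\<close>, so the previous
  stage applies inside \<open>G\<close>.\<close>

lemma adjoint_arens_second_dual:
  fixes T :: "'a::riesz_algebra \<Rightarrow> 'b::riesz_algebra"
  assumes T: "positive_operator T" and mult: "\<And>x y. T (x * y) = T x * T y"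
  shows "adjoint T (arens_second_dual (second_adjoint T G) g) = arens_second_dual G (adjoint T g)"
  by (rule order_dual_eqI)
    (simp add: adjoint_apply[OF positive_operatorD[OF T]] arens_second_dual.rep_eq
      second_adjoint_apply[OF T] adjoint_arens_dual_elem[OF T mult])

lemma second_adjoint_arens_mult:
  fixes T :: "'a::riesz_algebra \<Rightarrow> 'b::riesz_algebra"
  assumes T: "positive_operator T" and mult: "\<And>x y. T (x * y) = T x * T y"
  shows "second_adjoint T (arens_mult F G) =
    arens_mult (second_adjoint T F) (second_adjoint T G)"
  by (rule order_dual_eqI)
    (simp add: second_adjoint_apply[OF T] arens_mult.rep_eq adjoint_arens_second_dual[OF T mult])

lift_definition evaluation :: "'a::riesz_space \<Rightarrow> 'a second_dual"
  is "\<lambda>a f. dual_apply f a"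
proof -
  fix a :: 'a
  have lin: "linear (\<lambda>f. dual_apply f x)" for x :: 'a
    by (rule linearI) (simp_all add: plus_order_dual.rep_eq scaleR_order_dual.rep_eq)
  \<comment> \<open>Evaluation at a positive element is positive, and every element is a difference of such.\<close>
  have "order_bounded (\<lambda>f. dual_apply f a)"
  proof (rule order_bounded_diff_of_positive)
    show "dual_apply f a = dual_apply f (sup a 0) - dual_apply f (sup (- a) 0)" for f
      by (simp only: riesz_split flip: linear_diff[OF linear_dual_apply])
    show "positive_operator (\<lambda>f. dual_apply f (sup a 0))"
      "positive_operator (\<lambda>f. dual_apply f (sup (- a) 0))"
      by (simp_all add: positive_operator_def lin dual_le_iff zero_order_dual.rep_eq)
  qed
  with lin show "linear (\<lambda>f. dual_apply f a) \<and> order_bounded (\<lambda>f. dual_apply f a)" by blast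
qed

text \<open>Writing \<open>a''\<close> for evaluation at \<open>a\<close>, the three stages unwind to
  \<open>(a'' \<cdot> b'')(f) = (b'' \<cdot> f)(a) = (f \<cdot> a)(b) = f (a b)\<close>.\<close>

lemma evaluation_mult: "evaluation (a * b) = arens_mult (evaluation a) (evaluation b)"
  by (rule order_dual_eqI)
    (simp add: evaluation.rep_eq arens_mult.rep_eq arens_second_dual.rep_eq
      arens_dual_elem.rep_eq)

lemma second_adjoint_evaluation:
  assumes "positive_operator T"
  shows "second_adjoint T (evaluation a) = evaluation (T a)"
  by (rule order_dual_eqI)
    (simp add: second_adjoint_apply[OF assms] evaluation.rep_eq
      adjoint_apply[OF positive_operatorD[OF assms]])

lemma evaluation_inject:
  fixes a b :: "'a::riesz_space"
  assumes sep: "point_separating_dual TYPE('a)" and eq: "evaluation a = evaluation b"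
  shows "a = b"
proof -
  have "dual_apply f (a - b) = 0" for f
    using arg_cong[OF eq, of "\<lambda>F. dual_apply F f"]
    by (simp add: evaluation.rep_eq linear_diff[OF linear_dual_apply])
  then show ?thesis using sep unfolding point_separating_dual_def by (metis right_minus_eq)
qed

theorem theorem1:
  fixes T :: "'a::f_algebra \<Rightarrow> 'b::f_algebra"
    and E1 :: "'a second_dual" and E2 :: "'b second_dual"
  assumes "semiprime TYPE('a)" and "semiprime TYPE('b)"
    and "point_separating_dual TYPE('a)" and "point_separating_dual TYPE('b)"
    and "arens_unit E1" and "arens_unit E2"
    and "pre_markov_operator E1 E2 T"
  shows "algebra_homomorphism (*) (*) T \<longleftrightarrow>
    algebra_homomorphism arens_mult arens_mult (second_adjoint T)"
proof
  have T: "positive_operator T" using assms(7) by (simp add: pre_markov_operator_def)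
  show "algebra_homomorphism arens_mult arens_mult (second_adjoint T)"
    if "algebra_homomorphism (*) (*) T"
    using that second_adjoint_arens_mult[OF T]
      positive_operatorD(1)[OF positive_operator_second_adjoint[OF T]]
    by (simp add: algebra_homomorphism_def)
  show "algebra_homomorphism (*) (*) T"
    if hom: "algebra_homomorphism arens_mult arens_mult (second_adjoint T)"
    unfolding algebra_homomorphism_def
  proof (intro conjI allI)
    show "linear T" by (rule positive_operatorD(1)[OF T])
    fix x y
    have "evaluation (T (x * y)) = evaluation (T x * T y)"
      using hom
      by (simp add: algebra_homomorphism_def evaluation_mult
          flip: second_adjoint_evaluation[OF T])
    then show "T (x * y) = T x * T y" by (rule evaluation_inject[OF assms(4)])
  qed
qed

end
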